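(* Let $X$ be a simplicial P-complex in $V$ with compact cells, $S$ a supercommutative ring, and $v\in\mathcal{U}(X)$ a convenient point. Number the vertices of $X$ in ascending order of the values of the functional $v$. Then for all $r_p\in C^p(X,S)$, $r_q\in C^q(X,S)$ the product $r_p\smile_v r_q$ coincides with the Čech product: for every $(p+q)$-dimensional simplex $[u_0,\dots,u_{p+q}]$ of $X$ with vertices listed in increasing order, $$(r_p\smile_v r_q)([u_0,\dots,u_{p+q}])=r_p([u_0,\dots,u_p])\,r_q([u_p,u_{p+1},\dots,u_{p+q}]).$$
   Context: $V$ is a real vector space of finite dimension $n$, $V^*$ its dual. P-complex: a finite set $X$ of closed convex polyhedra in $V$ (its cells) such that every face of a cell is a cell and every non-empty intersection of two cells is a common face of both. All cells are assumed compact. It is simplicial if every cell is a simplex; $[u_0,\dots,u_m]$ denotes the simplex with these vertices, oriented by the order of the vertices. Cochains: $S$ is a supercommutative ring ($\mathbb{Z}/2$-graded, $ab=(-1)^{|a||b|}ba$ for homogeneous $a,b$). $C^p(X,S)$ is the module of functions from oriented $p$-dimensional cells to $S$ that change sign when the orientation of the cell is reversed. For a cell $\delta$, $V_\delta\subset V$ is the linear subspace generated by differences of points of $\delta$. For a cell $\gamma$, let $X_\gamma$ be the P-complex in $V_\gamma$ of faces of $\gamma$ ($\gamma$ translated into $V_\gamma$; the choice is immaterial). For a face $\delta$ of $\gamma$ the dual cone $\delta^*\subset (V_\gamma)^*$ consists of all $w\in(V_\gamma)^*$ for which the maximum of $w$ on $\gamma$ is attained at every point of $\delta$; $\dim\delta^*=\dim\gamma-\dim\delta$.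 These cones form the dual fan $X_\gamma^*$, with $j$-dimensional skeleton $(X_\gamma^* )^j$. Let $\pi_\gamma\colon V^*\to(V_\gamma)^*$ be the restriction map. Two P-complexes in a space are transversal if for any cells $\delta_1,\delta_2$ of them with $\delta_1\cap\delta_2\ne\emptyset$ one has $\operatorname{codim}(V_{\delta_1}\cap V_{\delta_2})=\operatorname{codim}V_{\delta_1}+\operatorname{codim}V_{\delta_2}$. A point $v\in V^*$ is $(p,q)$-convenient if $\pi_\gamma(v)+(X_\gamma^* )^q$ and $(X_\gamma^* )^p$ are transversal for every $\gamma\in X$ with $\dim\gamma=p+q$; $\mathcal{U}_{p,q}(X)$ is the set of such points, and $\mathcal{U}(X)=\bigcap_{p,q}\mathcal{U}_{p,q}(X)$ is the set of convenient points. Product: for $v\in\mathcal{U}_{p,q}(X)$ and an oriented cell $\gamma$ of dimension $p+q$, $(r_p\smile_v r_q)(\gamma)=\sum_{(\delta,\lambda)\in\mathcal{P}(p,q,\gamma,v)}r_p(\delta)r_q(\lambda)$, where $\mathcal{P}(p,q,\gamma,v)$ is the set of pairs $(\delta,\lambda)$ of faces of $\gamma$ of dimensions $p,q$ with $(\pi_\gamma(v)+\delta^* )\cap\lambda^*\neq\emptyset$, oriented so that $V_\gamma=V_\delta\oplus V_\lambda$ as oriented spaces. *)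

theory Defs
  imports
    "HOL-Analysis.Analysis"
    "HOL-Library.Function_Algebras"
    "Jordan_Normal_Form.Determinant"
begin

section \<open>Functionals on subspaces\<close>

instantiation "fun" :: (type, real_vector) real_vector
begin

definition scaleR_fun :: "real \<Rightarrow> ('a \<Rightarrow> 'b) \<Rightarrow> 'a \<Rightarrow> 'b"
  where "scaleR_fun c f = (\<lambda>x. c *\<^sub>R f x)"

instance
  by standard (auto simp: scaleR_fun_def fun_eq_iff scaleR_add_right scaleR_add_left)

end

text \<open>
  A linear functional on a subspace \<open>W\<close> is encoded as a function on the ambient type that is
  linear on \<open>W\<close> and vanishes outside \<open>W\<close>.  The dual of \<open>W\<close> is thereby a linear subspace
  of the function space, and \<open>dual_space UNIV\<close> is the set of all linear functionals.
\<close>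

definition dual_space :: "'a::real_vector set \<Rightarrow> ('a \<Rightarrow> real) set" where
  "dual_space W =
    {w. (\<forall>x\<in>W. \<forall>y\<in>W. w (x + y) = w x + w y) \<and>
        (\<forall>c. \<forall>x\<in>W. w (c *\<^sub>R x) = c * w x) \<and>
        (\<forall>x. x \<notin> W \<longrightarrow> w x = 0)}"

definition restrict_functional :: "'a set \<Rightarrow> ('a \<Rightarrow> real) \<Rightarrow> 'a \<Rightarrow> real" where
  "restrict_functional W v = (\<lambda>x. if x \<in> W then v x else 0)"


section \<open>Complexes of polyhedra\<close>

definition cell_dir :: "'a::real_vector set \<Rightarrow> 'a set" where
  "cell_dir c = span {x - y | x y. x \<in> c \<and> y \<in> c}"

text \<open>
  For a non-empty subset of a Euclidean space \<open>cell_dim\<close> agrees with \<^const>\<open>aff_dim\<close>;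
  it is also needed for cones in spaces of functionals.
\<close>

definition cell_dim :: "'a::real_vector set \<Rightarrow> nat" where
  "cell_dim c = dim (cell_dir c)"

definition faces :: "'a::real_vector set \<Rightarrow> 'a set set" where
  "faces c = {d. d face_of c \<and> d \<noteq> {}}"

definition p_complex :: "'a::euclidean_space set set \<Rightarrow> bool" where
  "p_complex X \<longleftrightarrow>
    finite X \<and>
    (\<forall>c\<in>X. polyhedron c \<and> c \<noteq> {}) \<and>
    (\<forall>c\<in>X. faces c \<subseteq> X) \<and>
    (\<forall>c\<in>X. \<forall>d\<in>X. c \<inter> d \<noteq> {} \<longrightarrow> c \<inter> d \<in> faces c \<and> c \<inter> d \<in> faces d)"

definition simplicial :: "'a::euclidean_space set set \<Rightarrow> bool" where
  "simplicial X \<longleftrightarrow> (\<forall>c\<in>X. \<exists>k. k simplex c)"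

definition complex_vertices :: "'a set set \<Rightarrow> 'a set" where
  "complex_vertices X = {x. {x} \<in> X}"


section \<open>Dual fans and convenient points\<close>

text \<open>
  The base point \<open>a\<close> translates the cell \<open>\<gamma>\<close> into the subspace \<open>cell_dir \<gamma>\<close>, on which
  \<open>w\<close> is defined; the condition does not depend on \<open>a\<close>.
\<close>

definition dual_cone :: "'a::real_vector set \<Rightarrow> 'a set \<Rightarrow> ('a \<Rightarrow> real) set" where
  "dual_cone \<gamma> \<delta> =
    {w \<in> dual_space (cell_dir \<gamma>).
      \<forall>a\<in>\<gamma>. \<forall>x\<in>\<delta>. \<forall>y\<in>\<gamma>. w (y - a) \<le> w (x - a)}"

definition dual_fan :: "'a::real_vector set \<Rightarrow> ('a \<Rightarrow> real) set set" where
  "dual_fan \<gamma> = dual_cone \<gamma> ` faces \<gamma>"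

definition skeleton :: "nat \<Rightarrow> 'b::real_vector set set \<Rightarrow> 'b set set" where
  "skeleton j Y = {c \<in> Y. cell_dim c \<le> j}"

definition codim_in :: "'b::real_vector set \<Rightarrow> 'b set \<Rightarrow> int" where
  "codim_in E U = int (dim E) - int (dim U)"

definition transversal :: "'b::real_vector set \<Rightarrow> 'b set set \<Rightarrow> 'b set set \<Rightarrow> bool" where
  "transversal E Y Z \<longleftrightarrow>
    (\<forall>c\<in>Y. \<forall>d\<in>Z. c \<inter> d \<noteq> {} \<longrightarrow>
      codim_in E (cell_dir c \<inter> cell_dir d) =
      codim_in E (cell_dir c) + codim_in E (cell_dir d))"

definition shifted_cone ::
    "('a::real_vector \<Rightarrow> real) \<Rightarrow> 'a set \<Rightarrow> ('a \<Rightarrow> real) set \<Rightarrow> ('a \<Rightarrow> real) set" where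
  "shifted_cone v \<gamma> c = (\<lambda>w. restrict_functional (cell_dir \<gamma>) v + w) ` c"

definition convenient_pq ::
    "'a::real_vector set set \<Rightarrow> nat \<Rightarrow> nat \<Rightarrow> ('a \<Rightarrow> real) set" where
  "convenient_pq X p q =
    {v \<in> dual_space UNIV. \<forall>\<gamma>\<in>X. cell_dim \<gamma> = p + q \<longrightarrow>
      transversal (dual_space (cell_dir \<gamma>))
        (shifted_cone v \<gamma> ` skeleton q (dual_fan \<gamma>))
        (skeleton p (dual_fan \<gamma>))}"

definition convenient :: "'a::real_vector set set \<Rightarrow> ('a \<Rightarrow> real) set" where
  "convenient X = (\<Inter>p. \<Inter>q. convenient_pq X p q)"


section \<open>Orientations and cochains\<close>

definition ordered_basis :: "'a::real_vector set \<Rightarrow> 'a list \<Rightarrow> bool" where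
  "ordered_basis W bs \<longleftrightarrow> distinct bs \<and> independent (set bs) \<and> span (set bs) = W"

definition basis_change_det :: "'a::real_vector list \<Rightarrow> 'a list \<Rightarrow> real" where
  "basis_change_det bs cs =
    Determinant.det
      (mat (length bs) (length bs) (\<lambda>(i, j). representation (set bs) (cs ! j) (bs ! i)))"

text \<open>
  An orientation assigns a sign to every ordered basis, compatibly with basis change (and, by
  convention, the value 0 to other lists).  In this way a space of dimension 0, whose
  only ordered basis is the empty list, has two opposite orientations as well.
\<close>

type_synonym 'a orientation = "'a list \<Rightarrow> real"

definition orientations :: "'a::real_vector set \<Rightarrow> 'a orientation set" where
  "orientations W =
    {\<epsilon>. (\<forall>bs. ordered_basis W bs \<longrightarrow> \<epsilon> bs \<in> {1, - 1}) \<and>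
        (\<forall>bs. \<not> ordered_basis W bs \<longrightarrow> \<epsilon> bs = 0) \<and>
        (\<forall>bs cs. ordered_basis W bs \<longrightarrow> ordered_basis W cs \<longrightarrow>
           \<epsilon> cs = sgn (basis_change_det bs cs) * \<epsilon> bs)}"

definition orientation_of :: "'a::real_vector list \<Rightarrow> 'a orientation" where
  "orientation_of bs =
    (\<lambda>cs. if ordered_basis (span (set bs)) cs then sgn (basis_change_det bs cs) else 0)"

type_synonym 'a ocell = "'a set \<times> 'a orientation"

definition oriented_cells :: "'a::real_vector set set \<Rightarrow> nat \<Rightarrow> 'a ocell set" where
  "oriented_cells X p =
    {(c, \<epsilon>). c \<in> X \<and> cell_dim c = p \<and> \<epsilon> \<in> orientations (cell_dir c)}"

text \<open>The simplex with the given vertices, oriented by their order.\<close>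

definition oriented_simplex :: "'a::real_vector list \<Rightarrow> 'a ocell" where
  "oriented_simplex us =
    (convex hull (set us), orientation_of (map (\<lambda>u. u - hd us) (tl us)))"

text \<open>
  Values outside \<open>oriented_cells X p\<close> are irrelevant and left unconstrained.
\<close>

definition cochains :: "'a::real_vector set set \<Rightarrow> nat \<Rightarrow> ('a ocell \<Rightarrow> 's::ring) set" where
  "cochains X p = {r. \<forall>(c, \<epsilon>)\<in>oriented_cells X p. r (c, - \<epsilon>) = - r (c, \<epsilon>)}"

definition supercommutative :: "(nat \<Rightarrow> 's::{ring,monoid_mult} set) \<Rightarrow> bool" where
  "supercommutative G \<longleftrightarrow>
    (\<forall>i<2. 0 \<in> G i \<and> (\<forall>a\<in>G i. - a \<in> G i \<and> (\<forall>b\<in>G i. a + b \<in> G i))) \<and>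
    (\<forall>a. \<exists>b\<in>G 0. \<exists>c\<in>G 1. a = b + c) \<and> G 0 \<inter> G 1 = {0} \<and>
    (\<forall>i<2. \<forall>j<2. \<forall>a\<in>G i. \<forall>b\<in>G j.
       a * b \<in> G ((i + j) mod 2) \<and> a * b = (- 1) ^ (i * j) * (b * a))"


section \<open>The product\<close>

definition face_pairs ::
    "nat \<Rightarrow> nat \<Rightarrow> 'a::real_vector set \<Rightarrow> ('a \<Rightarrow> real) \<Rightarrow> ('a set \<times> 'a set) set" where
  "face_pairs p q \<gamma> v =
    {(\<delta>, \<mu>). \<delta> \<in> faces \<gamma> \<and> \<mu> \<in> faces \<gamma> \<and> cell_dim \<delta> = p \<and> cell_dim \<mu> = q \<and>
      shifted_cone v \<gamma> (dual_cone \<gamma> \<delta>) \<inter> dual_cone \<gamma> \<mu> \<noteq> {}}"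

definition oriented_direct_sum ::
    "'a::real_vector set \<Rightarrow> 'a orientation \<Rightarrow> 'a set \<Rightarrow> 'a orientation \<Rightarrow>
     'a set \<Rightarrow> 'a orientation \<Rightarrow> bool" where
  "oriented_direct_sum W \<epsilon> W1 \<epsilon>1 W2 \<epsilon>2 \<longleftrightarrow>
    \<epsilon> \<in> orientations W \<and> \<epsilon>1 \<in> orientations W1 \<and> \<epsilon>2 \<in> orientations W2 \<and>
    W1 \<inter> W2 = {0} \<and> W = {x + y | x y. x \<in> W1 \<and> y \<in> W2} \<and>
    (\<forall>bs cs. ordered_basis W1 bs \<longrightarrow> ordered_basis W2 cs \<longrightarrow>
       \<epsilon> (bs @ cs) = \<epsilon>1 bs * \<epsilon>2 cs)"

text \<open>
  For given faces there are two compatible pairs of orientations, differing by a simultaneous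
  reversal; for cochains the product of the two values does not depend on which pair is
  chosen.
\<close>

definition cup ::
    "nat \<Rightarrow> nat \<Rightarrow> ('a::real_vector \<Rightarrow> real) \<Rightarrow> ('a ocell \<Rightarrow> 's::ring) \<Rightarrow> ('a ocell \<Rightarrow> 's) \<Rightarrow>
     'a ocell \<Rightarrow> 's" where
  "cup p q v r s = (\<lambda>(\<gamma>, \<epsilon>).
    \<Sum>(\<delta>, \<mu>) \<in> face_pairs p q \<gamma> v.
      let (\<epsilon>1, \<epsilon>2) =
        (SOME (\<epsilon>1, \<epsilon>2).
          oriented_direct_sum (cell_dir \<gamma>) \<epsilon> (cell_dir \<delta>) \<epsilon>1 (cell_dir \<mu>) \<epsilon>2)
      in r (\<delta>, \<epsilon>1) * s (\<mu>, \<epsilon>2))"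

end

theory Submission
  imports Defs
begin

text \<open>
  Let \<open>u\<^sub>0, \<dots>, u\<^sub>n\<close> with \<open>n = p + q\<close> be the vertices of a simplex \<open>\<gamma>\<close> in increasing order. A
  functional on \<open>V\<^sub>\<gamma>\<close> is the same as a family of values at the vertices up to an additive constant,
  and it lies in the cone dual to the face with vertex set \<open>I\<close> iff its maximum over the vertices is
  attained on all of \<open>I\<close>. From this description, the shifted cone of \<open>I\<close> meets the cone of \<open>J\<close> iff
  \<open>v i \<le> v j\<close> for all \<open>i \<in> I\<close> and \<open>j \<in> J\<close> (\<open>shifted_dual_cone_meets_iff\<close>; the witness is the
  truncation of \<open>v\<close> at the maximum of \<open>v\<close> on \<open>I\<close>).

  A convenient functional takes different values at the two ends of an edge
  (\<open>convenient_distinct_on_edge\<close>). As every two vertices of a simplex span an edge, \<open>v\<close> is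
  strictly increasing along \<open>u\<^sub>0, \<dots>, u\<^sub>n\<close>. Sets \<open>I\<close> and \<open>J\<close> with \<open>p + 1\<close> and \<open>q + 1\<close> elements
  overlap, since there are only \<open>p + q + 1\<close> vertices; so they can satisfy the condition above only
  if they are the front part up to \<open>u\<^sub>p\<close> and the back part from \<open>u\<^sub>p\<close> on (\<open>face_pairs_simplex\<close>).
  The sum defining the product therefore has a single term.

  It remains to compare orientations. The vertex orders of front and back face are compatible with
  that of \<open>\<gamma>\<close>, because the corresponding bases of edge vectors differ by a unitriangular
  matrix (\<open>oriented_direct_sum_simplex\<close>). Compatible orientations are unique up to a
  simultaneous reversal (\<open>oriented_direct_sum_unique\<close>), under which a product of two cochain
  values is invariant.
\<close>

section \<open>Orientations and basis changes\<close>

definition basis_change_mat :: "'a::real_vector list \<Rightarrow> 'a list \<Rightarrow> real mat" where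
  "basis_change_mat bs cs =
    mat (length bs) (length bs) (\<lambda>(i, j). representation (set bs) (cs ! j) (bs ! i))"

lemma basis_change_det_mat: "basis_change_det bs cs = Determinant.det (basis_change_mat bs cs)"
  by (simp add: basis_change_det_def basis_change_mat_def)

lemma ordered_basis_length: "ordered_basis W bs \<Longrightarrow> length bs = dim W"
  unfolding ordered_basis_def
  by (metis distinct_card real_vector.dim_span real_vector.dim_eq_card_independent)

text \<open>
  Writing a vector of the third basis in the second one, and each vector of the second basis in
  the first one, is multiplication of coordinate matrices. Hence determinants of basis changes
  multiply, and their signs define orientations.
\<close>

lemma basis_change_mat_trans:
  assumes "ordered_basis W bs" "ordered_basis W cs" "ordered_basis W ds"
  shows "basis_change_mat bs ds = basis_change_mat bs cs * basis_change_mat cs ds"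
proof (rule eq_matI)
  have len: "length bs = dim W" "length cs = dim W" "length ds = dim W"
    using assms ordered_basis_length by auto
  show "dim_row (basis_change_mat bs ds) = dim_row (basis_change_mat bs cs * basis_change_mat cs ds)"
    "dim_col (basis_change_mat bs ds) = dim_col (basis_change_mat bs cs * basis_change_mat cs ds)"
    by (auto simp: basis_change_mat_def len)
  fix i j
  assume "i < dim_row (basis_change_mat bs cs * basis_change_mat cs ds)"
    and "j < dim_col (basis_change_mat bs cs * basis_change_mat cs ds)"
  then have ij: "i < dim W" "j < dim W" by (auto simp: basis_change_mat_def len)
  have ind: "independent (set bs)" "independent (set cs)" and dist: "distinct cs"
    and span: "span (set bs) = W" "span (set cs) = W" "span (set ds) = W"
    using assms unfolding ordered_basis_def by auto
  have cW: "c \<in> span (set bs)" if "c \<in> set cs" for c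
    using that span real_vector.span_base by metis
  have dj: "ds ! j \<in> span (set cs)"
    using ij len span real_vector.span_base[of "ds ! j" "set ds"] by auto
  have "representation (set bs) (ds ! j) (bs ! i)
      = representation (set bs) (\<Sum>c\<in>set cs. representation (set cs) (ds ! j) c *\<^sub>R c) (bs ! i)"
    using real_vector.sum_representation_eq[OF ind(2) dj, of "set cs"] by simp
  also have "\<dots> = (\<Sum>c\<in>set cs. representation (set cs) (ds ! j) c * representation (set bs) c (bs ! i))"
    by (simp add: real_vector.representation_sum[OF ind(1)] real_vector.representation_scale[OF ind(1)]
        real_vector.span_scale cW)
  also have "\<dots> = (\<Sum>k<dim W. representation (set bs) (cs ! k) (bs ! i) * representation (set cs) (ds ! j) (cs ! k))"
    by (subst sum.reindex_bij_betw[OF bij_betw_nth[OF dist refl refl], symmetric])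
      (simp add: len mult.commute)
  finally show "basis_change_mat bs ds $$ (i, j) = (basis_change_mat bs cs * basis_change_mat cs ds) $$ (i, j)"
    using ij by (simp add: basis_change_mat_def len scalar_prod_def atLeast0LessThan)
qed

lemma basis_change_det_trans:
  assumes "ordered_basis W bs" "ordered_basis W cs" "ordered_basis W ds"
  shows "basis_change_det bs ds = basis_change_det bs cs * basis_change_det cs ds"
  unfolding basis_change_det_mat basis_change_mat_trans[OF assms]
  by (rule det_mult[of _ "dim W"])
    (use assms[THEN ordered_basis_length] in \<open>simp_all add: basis_change_mat_def\<close>)

lemma representation_nth:
  assumes "ordered_basis W bs" "i < length bs" "j < length bs"
  shows "representation (set bs) (bs ! j) (bs ! i) = (if i = j then 1 else 0)"
  using assms unfolding ordered_basis_def
  by (simp add: real_vector.representation_basis nth_eq_iff_index_eq)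

lemma basis_change_det_self:
  assumes "ordered_basis W bs"
  shows "basis_change_det bs bs = 1"
proof -
  have "basis_change_mat bs bs = 1\<^sub>m (length bs)"
    by (rule eq_matI) (auto simp: basis_change_mat_def representation_nth[OF assms])
  then show ?thesis by (simp add: basis_change_det_mat)
qed

lemma basis_change_det_nonzero:
  assumes "ordered_basis W bs" "ordered_basis W cs"
  shows "basis_change_det bs cs \<noteq> 0"
  using basis_change_det_trans[OF assms assms(1)] basis_change_det_self[OF assms(1)] by auto

lemma orientation_of_in_orientations:
  assumes "ordered_basis W bs"
  shows "orientation_of bs \<in> orientations W"
proof -
  have W: "span (set bs) = W" using assms by (simp add: ordered_basis_def)
  show ?thesis
    unfolding orientations_def orientation_of_def W
  proof (intro CollectI conjI allI impI)
    fix cs assume cs: "ordered_basis W cs"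
    show "(if ordered_basis W cs then sgn (basis_change_det bs cs) else 0) \<in> {1, - 1}"
      using basis_change_det_nonzero[OF assms cs] cs by (simp add: sgn_real_def)
    fix ds assume ds: "ordered_basis W ds"
    show "(if ordered_basis W ds then sgn (basis_change_det bs ds) else 0) =
      sgn (basis_change_det cs ds) * (if ordered_basis W cs then sgn (basis_change_det bs cs) else 0)"
      using cs ds by (simp add: basis_change_det_trans[OF assms cs ds] sgn_mult)
  qed simp
qed

lemma orientations_sign:
  "\<epsilon> \<in> orientations W \<Longrightarrow> ordered_basis W bs \<Longrightarrow> \<epsilon> bs = 1 \<or> \<epsilon> bs = - 1"
  unfolding orientations_def by blast

lemma orientations_outside:
  "\<epsilon> \<in> orientations W \<Longrightarrow> \<not> ordered_basis W bs \<Longrightarrow> \<epsilon> bs = 0"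
  unfolding orientations_def by blast

lemma orientations_change:
  "\<epsilon> \<in> orientations W \<Longrightarrow> ordered_basis W bs \<Longrightarrow> ordered_basis W cs \<Longrightarrow>
    \<epsilon> cs = sgn (basis_change_det bs cs) * \<epsilon> bs"
  unfolding orientations_def by blast

lemma orientations_eqI:
  assumes "\<epsilon> \<in> orientations W" "\<epsilon>' \<in> orientations W" "ordered_basis W bs" "\<epsilon> bs = \<epsilon>' bs"
  shows "\<epsilon> = \<epsilon>'"
proof
  fix cs
  show "\<epsilon> cs = \<epsilon>' cs"
  proof (cases "ordered_basis W cs")
    case True
    show ?thesis
      unfolding orientations_change[OF assms(1,3) True] orientations_change[OF assms(2,3) True] assms(4) ..
  next
    case False
    then show ?thesis using assms(1,2) by (simp add: orientations_outside)
  qed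
qed

lemma orientations_uminus:
  assumes "\<epsilon> \<in> orientations W"
  shows "- \<epsilon> \<in> orientations W"
  unfolding orientations_def
proof (intro CollectI conjI allI impI)
  fix bs assume bs: "ordered_basis W bs"
  show "(- \<epsilon>) bs \<in> {1, - 1}" using orientations_sign[OF assms bs] by auto
  fix cs assume cs: "ordered_basis W cs"
  show "(- \<epsilon>) cs = sgn (basis_change_det bs cs) * (- \<epsilon>) bs"
    by (simp add: orientations_change[OF assms bs cs])
qed (simp add: orientations_outside[OF assms])

text \<open>
  An orientation is determined by its sign on one ordered basis, so there are no others than an
  orientation and its reversal.
\<close>

lemma orientations_same_or_opposite:
  assumes "\<epsilon> \<in> orientations W" "\<epsilon>' \<in> orientations W" "ordered_basis W bs"
  shows "\<epsilon>' = (if \<epsilon>' bs = \<epsilon> bs then \<epsilon> else - \<epsilon>)"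
proof (cases "\<epsilon>' bs = \<epsilon> bs")
  case True
  then show ?thesis using orientations_eqI[OF assms(2,1,3)] by simp
next
  case False
  then have "\<epsilon>' bs = (- \<epsilon>) bs"
    using orientations_sign[OF assms(1,3)] orientations_sign[OF assms(2,3)] by auto
  then show ?thesis
    using False orientations_eqI[OF assms(2) orientations_uminus[OF assms(1)] assms(3)] by simp
qed

section \<open>Direct sums of oriented spaces\<close>

lemma span_disjoint_parts_of_basis:
  assumes "independent (A \<union> B)" "A \<inter> B = {}"
  shows "span A \<inter> span B = {0}"
proof -
  have "x = 0" if x: "x \<in> span A" "x \<in> span B" for x
  proof -
    have "representation (A \<union> B) x b = 0" for b
      using real_vector.representation_extend[OF assms(1) x(1)]
        real_vector.representation_extend[OF assms(1) x(2)]
        real_vector.representation_ne_zero[of A x b] real_vector.representation_ne_zero[of B x b] assms(2)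
      by fastforce
    moreover have "x \<in> span (A \<union> B)" using x real_vector.span_mono[of A "A \<union> B"] by auto
    ultimately show "x = 0"
      using real_vector.sum_nonzero_representation_eq[OF assms(1), of x] by simp
  qed
  then show ?thesis by (auto simp: real_vector.span_zero)
qed


text \<open>
  If both bases respect the same direct sum decomposition, then coordinates of a vector of one
  summand vanish on the other summand, so the coordinate matrix is block diagonal.
\<close>

lemma basis_change_det_append:
  assumes bs: "ordered_basis W (bs1 @ bs2)"
    and 1: "ordered_basis W1 bs1" "ordered_basis W1 cs1"
    and 2: "ordered_basis W2 bs2" "ordered_basis W2 cs2"
  shows "basis_change_det (bs1 @ bs2) (cs1 @ cs2) = basis_change_det bs1 cs1 * basis_change_det bs2 cs2"
proof -
  have len: "length cs1 = length bs1" "length cs2 = length bs2"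
    using ordered_basis_length 1 2 by metis+
  have ind: "independent (set bs1 \<union> set bs2)" and disj: "set bs1 \<inter> set bs2 = {}"
    using bs unfolding ordered_basis_def by auto
  have c1: "c \<in> span (set bs1)" if "c \<in> set cs1" for c
    using that 1 real_vector.span_base unfolding ordered_basis_def by metis
  have c2: "c \<in> span (set bs2)" if "c \<in> set cs2" for c
    using that 2 real_vector.span_base unfolding ordered_basis_def by metis
  have r1: "representation (set bs1 \<union> set bs2) c = representation (set bs1) c" if "c \<in> set cs1" for c
    by (rule real_vector.representation_extend[OF ind c1[OF that]]) auto
  have r2: "representation (set bs1 \<union> set bs2) c = representation (set bs2) c" if "c \<in> set cs2" for c
    by (rule real_vector.representation_extend[OF ind c2[OF that]]) auto
  have z1: "representation (set bs1) c b = 0" if "b \<in> set bs2" for c b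
    using disj that real_vector.representation_ne_zero[of "set bs1" c b] by auto
  have z2: "representation (set bs2) c b = 0" if "b \<in> set bs1" for c b
    using disj that real_vector.representation_ne_zero[of "set bs2" c b] by auto
  have "basis_change_mat (bs1 @ bs2) (cs1 @ cs2) =
    four_block_mat (basis_change_mat bs1 cs1) (0\<^sub>m (length bs1) (length bs2))
      (0\<^sub>m (length bs2) (length bs1)) (basis_change_mat bs2 cs2)"
    by (rule eq_matI)
      (auto simp: basis_change_mat_def nth_append len r1 r2 z1 z2)
  then show ?thesis
    unfolding basis_change_det_mat
    by (simp add: basis_change_mat_def det_four_block_mat_upper_right_zero[of _ "length bs1" _ "length bs2"])
qed

text \<open>
  A spanning list of length equal to the dimension contains a basis of the same length, so it is
  that basis. This spares direct proofs of independence for the lists below.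
\<close>

lemma ordered_basis_if_spans:
  assumes bs: "ordered_basis W bs" and span: "span (set cs) = W" and len: "length cs = length bs"
  shows "ordered_basis W cs"
proof -
  obtain B where B: "B \<subseteq> set cs" "independent B" "set cs \<subseteq> span B"
    using real_vector.maximal_independent_subset[of "set cs"] by metis
  have "span B = W"
    using B span real_vector.span_mono[OF B(1)] real_vector.span_minimal[OF B(3)] by auto
  then have "card B = length cs"
    using real_vector.dim_eq_card_independent[OF B(2)] real_vector.dim_span[of B]
      ordered_basis_length[OF bs] len by simp
  moreover have "card B \<le> card (set cs)" "card (set cs) \<le> length cs"
    using B(1) by (simp_all add: card_mono card_length)
  ultimately have "card (set cs) = length cs" "B = set cs"
    using B(1) by (simp_all add: card_subset_eq)
  then show ?thesis
    using B(2) span by (simp add: ordered_basis_def card_distinct)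
qed

lemma span_append:
  "span (set (bs @ cs)) = {x + y |x y. x \<in> span (set bs) \<and> y \<in> span (set cs)}"
  by (auto simp: real_vector.span_Un)

text \<open>
  A perturbation of each basis vector by a combination of earlier basis vectors has an upper
  triangular coordinate matrix with ones on the diagonal. The change from the edge vectors at the
  first vertex of a simplex to the edge vectors of its front and back faces has this form.
\<close>

lemma
  assumes bs: "ordered_basis W bs" and len: "length cs = length bs"
    and diff: "\<And>j. j < length bs \<Longrightarrow> cs ! j - bs ! j \<in> span (set (take j bs))"
  shows ordered_basis_unitriangular: "ordered_basis W cs"
    and basis_change_det_unitriangular: "basis_change_det bs cs = 1"
proof -
  have ind: "independent (set bs)" and W: "span (set bs) = W" and dist: "distinct bs"
    using bs by (auto simp: ordered_basis_def)
  have take_W: "span (set (take j bs)) \<subseteq> W" for j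
    using real_vector.span_mono[OF set_take_subset] W by blast
  have bs_W: "bs ! j \<in> W" if "j < length bs" for j
    using W that real_vector.span_base by (metis nth_mem)
  have cs_W: "cs ! j \<in> W" if "j < length bs" for j
  proof -
    have "(cs ! j - bs ! j) + bs ! j \<in> span (set bs)"
      using diff[OF that] take_W[of j] bs_W[OF that] W by (intro real_vector.span_add) auto
    then show ?thesis using W by simp
  qed
  \<comment> \<open>The old basis is recovered from the new list one vector at a time.\<close>
  have "set (take j bs) \<subseteq> span (set cs)" if "j \<le> length bs" for j
    using that
  proof (induction j)
    case (Suc j)
    then have IH: "set (take j bs) \<subseteq> span (set cs)" and j: "j < length bs" by auto
    have "cs ! j - bs ! j \<in> span (set cs)"
      using diff[OF j] real_vector.span_minimal[OF IH] by auto
    moreover have "cs ! j \<in> span (set cs)"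
      using j len by (simp add: real_vector.span_base)
    ultimately have "cs ! j - (cs ! j - bs ! j) \<in> span (set cs)"
      using real_vector.span_diff by blast
    then show ?case using IH j by (simp add: take_Suc_conv_app_nth)
  qed simp
  from this[of "length bs"] have "W \<subseteq> span (set cs)"
    using real_vector.span_minimal W by auto
  moreover have "set cs \<subseteq> W" using cs_W len by (auto simp: in_set_conv_nth)
  then have "span (set cs) \<subseteq> W" using W real_vector.span_minimal by (metis real_vector.subspace_span)
  ultimately show "ordered_basis W cs" using ordered_basis_if_spans[OF bs _ len] by blast
  have entry: "representation (set bs) (cs ! j) (bs ! i) =
      (if i = j then 1 else 0) + representation (set (take j bs)) (cs ! j - bs ! j) (bs ! i)"
    if "i < length bs" "j < length bs" for i j
  proof -
    have "representation (set bs) (bs ! j + (cs ! j - bs ! j)) (bs ! i) =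
      representation (set bs) (bs ! j) (bs ! i) + representation (set bs) (cs ! j - bs ! j) (bs ! i)"
      using bs_W[of j] diff[OF that(2)] take_W[of j] that W
      by (subst real_vector.representation_add[OF ind]) auto
    moreover have "representation (set bs) (cs ! j - bs ! j) = representation (set (take j bs)) (cs ! j - bs ! j)"
      using real_vector.representation_extend[OF ind diff[OF that(2)] set_take_subset] .
    ultimately show ?thesis using representation_nth[OF bs that] by simp
  qed
  have zero: "representation (set (take j bs)) (cs ! j - bs ! j) (bs ! i) = 0"
    if "j \<le> i" "i < length bs" for i j
  proof -
    have "bs ! i \<notin> set (take j bs)"
      using that dist by (auto simp: in_set_conv_nth nth_eq_iff_index_eq)
    then show ?thesis using real_vector.representation_ne_zero by metis
  qed
  let ?M = "basis_change_mat bs cs"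
  have "upper_triangular ?M"
    unfolding upper_triangular_def basis_change_mat_def by (auto simp: entry zero)
  moreover have "?M \<in> carrier_mat (length bs) (length bs)" by (simp add: basis_change_mat_def)
  ultimately have "Determinant.det ?M = prod_list (diag_mat ?M)" by (rule det_upper_triangular)
  moreover have "diag_mat ?M = map (\<lambda>i. 1) [0..<length bs]"
    unfolding diag_mat_def basis_change_mat_def by (auto simp: entry zero)
  moreover have "prod_list (map (\<lambda>i. 1 :: real) xs) = 1" for xs :: "nat list"
    by (induction xs) auto
  ultimately show "basis_change_det bs cs = 1"
    by (simp add: basis_change_det_mat)
qed

text \<open>
  It is enough to know the sign of one concatenated basis, because for all other bases of the
  summands the sign changes by the product of the two block determinants.
\<close>

lemma oriented_direct_sum_append:
  assumes bs: "ordered_basis W bs" and bs12: "ordered_basis W (bs1 @ bs2)"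
    and pos: "basis_change_det bs (bs1 @ bs2) > 0"
    and W1: "span (set bs1) = W1" and W2: "span (set bs2) = W2"
  shows "oriented_direct_sum W (orientation_of bs) W1 (orientation_of bs1) W2 (orientation_of bs2)"
proof -
  have W: "span (set (bs1 @ bs2)) = W" and ind: "independent (set bs1 \<union> set bs2)"
    and dist: "distinct (bs1 @ bs2)"
    using bs12 by (auto simp: ordered_basis_def)
  have bs1: "ordered_basis W1 bs1" and bs2: "ordered_basis W2 bs2"
    using W1 W2 dist real_vector.independent_mono[OF ind] by (auto simp: ordered_basis_def)
  have "orientation_of bs (cs1 @ cs2) = orientation_of bs1 cs1 * orientation_of bs2 cs2"
    if cs1: "ordered_basis W1 cs1" and cs2: "ordered_basis W2 cs2" for cs1 cs2
  proof -
    have "span (set cs1) = W1" "span (set cs2) = W2" using cs1 cs2 by (auto simp: ordered_basis_def)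
    then have "span (set (cs1 @ cs2)) = W"
      using W unfolding span_append W1 W2 by simp
    moreover have "length (cs1 @ cs2) = length (bs1 @ bs2)"
      using bs1 bs2 cs1 cs2 by (simp add: ordered_basis_length)
    ultimately have cs12: "ordered_basis W (cs1 @ cs2)" by (rule ordered_basis_if_spans[OF bs12])
    have "span (set bs) = W" using bs by (simp add: ordered_basis_def)
    then have "orientation_of bs (cs1 @ cs2) = sgn (basis_change_det bs (cs1 @ cs2))"
      using cs12 by (simp add: orientation_of_def)
    also have "\<dots> = sgn (basis_change_det (bs1 @ bs2) (cs1 @ cs2))"
      using pos by (simp add: basis_change_det_trans[OF bs bs12 cs12] sgn_mult)
    also have "\<dots> = sgn (basis_change_det bs1 cs1) * sgn (basis_change_det bs2 cs2)"
      by (simp add: basis_change_det_append[OF bs12 bs1 cs1 bs2 cs2] sgn_mult)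
    finally show ?thesis using cs1 cs2 W1 W2 by (simp add: orientation_of_def)
  qed
  moreover have "W1 \<inter> W2 = {0}"
    using span_disjoint_parts_of_basis[OF ind] dist W1 W2 by simp
  moreover have "W = {x + y |x y. x \<in> W1 \<and> y \<in> W2}"
    using W unfolding span_append W1 W2 by simp
  ultimately show ?thesis
    using orientation_of_in_orientations[OF bs] orientation_of_in_orientations[OF bs1]
      orientation_of_in_orientations[OF bs2]
    by (simp add: oriented_direct_sum_def)
qed

text \<open>
  Reversing only one of the two orientations would change the sign of the sum, so the choice of
  orientations is unique up to reversing both.
\<close>

lemma oriented_direct_sum_unique:
  assumes "oriented_direct_sum W \<epsilon> W1 \<epsilon>1 W2 \<epsilon>2" "oriented_direct_sum W \<epsilon> W1 \<epsilon>1' W2 \<epsilon>2'"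
    and bs: "ordered_basis W1 bs1" "ordered_basis W2 bs2"
  shows "(\<epsilon>1', \<epsilon>2') = (\<epsilon>1, \<epsilon>2) \<or> (\<epsilon>1', \<epsilon>2') = (- \<epsilon>1, - \<epsilon>2)"
proof -
  have e: "\<epsilon>1 \<in> orientations W1" "\<epsilon>1' \<in> orientations W1"
    "\<epsilon>2 \<in> orientations W2" "\<epsilon>2' \<in> orientations W2"
    and "\<epsilon>1' bs1 * \<epsilon>2' bs2 = \<epsilon>1 bs1 * \<epsilon>2 bs2"
    using assms unfolding oriented_direct_sum_def by metis+
  then have "\<epsilon>1' bs1 = \<epsilon>1 bs1 \<longleftrightarrow> \<epsilon>2' bs2 = \<epsilon>2 bs2"
    using orientations_sign[OF e(1) bs(1)] orientations_sign[OF e(2) bs(1)]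
      orientations_sign[OF e(3) bs(2)] orientations_sign[OF e(4) bs(2)] by auto
  then show ?thesis
    using orientations_same_or_opposite[OF e(1,2) bs(1)] orientations_same_or_opposite[OF e(3,4) bs(2)]
    by (auto split: if_splits)
qed

section \<open>Directions of a simplex\<close>

lemma cell_dir_convex_hull:
  assumes "a \<in> S"
  shows "cell_dir (convex hull S) = span ((\<lambda>x. x - a) ` S)"
proof
  have "convex {x. x - a \<in> span ((\<lambda>x. x - a) ` S)}"
  proof (intro convexI CollectI)
    fix x y and t s :: real
    assume "x \<in> {x. x - a \<in> span ((\<lambda>x. x - a) ` S)}" "y \<in> {x. x - a \<in> span ((\<lambda>x. x - a) ` S)}"
      and ts: "t + s = 1"
    then have "t *\<^sub>R (x - a) + s *\<^sub>R (y - a) \<in> span ((\<lambda>x. x - a) ` S)"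
      by (intro real_vector.span_add real_vector.span_scale) auto
    moreover have "t *\<^sub>R (x - a) + s *\<^sub>R (y - a) = t *\<^sub>R x + s *\<^sub>R y - (t + s) *\<^sub>R a"
      by (simp add: algebra_simps)
    ultimately show "t *\<^sub>R x + s *\<^sub>R y - a \<in> span ((\<lambda>x. x - a) ` S)"
      by (simp add: ts)
  qed
  then have hull: "convex hull S \<subseteq> {x. x - a \<in> span ((\<lambda>x. x - a) ` S)}"
    by (rule hull_minimal[rotated]) (auto intro: real_vector.span_base)
  have "x - y \<in> span ((\<lambda>x. x - a) ` S)" if "x \<in> convex hull S" "y \<in> convex hull S" for x y
    using that hull real_vector.span_diff[of "x - a" _ "y - a"] by (simp add: subset_iff)
  then show "cell_dir (convex hull S) \<subseteq> span ((\<lambda>x. x - a) ` S)"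
    unfolding cell_dir_def by (intro real_vector.span_minimal) auto
  show "span ((\<lambda>x. x - a) ` S) \<subseteq> cell_dir (convex hull S)"
    unfolding cell_dir_def using assms hull_inc[of _ S convex]
    by (intro real_vector.span_mono) blast
qed

lemma ordered_basis_simplex:
  assumes "us \<noteq> []" "distinct us" "\<not> affine_dependent (set us)"
  shows "ordered_basis (cell_dir (convex hull set us)) (map (\<lambda>u. u - hd us) (tl us))"
proof -
  obtain a xs where us: "us = a # xs" using assms(1) by (cases us) auto
  have "independent ((\<lambda>x. - a + x) ` (set us - {a}))"
    using assms(3) affine_dependent_iff_dependent2[of a "set us"] us by simp
  moreover have "set us - {a} = set xs" using us assms(2) by auto
  ultimately have "independent ((\<lambda>x. x - a) ` set xs)" by simp
  moreover have "span ((\<lambda>x. x - a) ` set xs) = cell_dir (convex hull set us)"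
    using cell_dir_convex_hull[of a "set us"] us by simp
  ultimately show ?thesis
    using us assms(2) by (simp add: ordered_basis_def distinct_map inj_on_def)
qed

lemma cell_dim_simplex:
  fixes S :: "'a::euclidean_space set"
  assumes "\<not> affine_dependent S" "S \<noteq> {}"
  shows "cell_dim (convex hull S) = card S - 1"
proof -
  have "finite S" using assms(1) aff_independent_finite by auto
  then obtain us where us: "set us = S" "distinct us" using finite_distinct_list by blast
  then have "ordered_basis (cell_dir (convex hull S)) (map (\<lambda>u. u - hd us) (tl us))"
    using ordered_basis_simplex[of us] assms by auto
  from ordered_basis_length[OF this] show ?thesis
    using us by (simp add: cell_dim_def distinct_card[symmetric])
qed

text \<open>
  Put \<open>e\<^sub>i = u\<^sub>i - u\<^sub>0\<close>. The space of the simplex is oriented by \<open>e\<^sub>1, \<dots>, e\<^sub>n\<close>, that of the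
  front face by \<open>e\<^sub>1, \<dots>, e\<^sub>p\<close>, and that of the back face by the vectors
  \<open>u\<^sub>j - u\<^sub>p = e\<^sub>j - e\<^sub>p\<close> with \<open>j > p\<close>. The concatenation of the last two lists arises from the
  first one by a unitriangular change (with \<open>e\<^sub>0 = 0\<close> when \<open>p = 0\<close>), so the signs agree.
\<close>

lemma oriented_direct_sum_simplex:
  assumes dist: "distinct us" and indep: "\<not> affine_dependent (set us)" and p: "p < length us"
  shows "oriented_direct_sum
     (cell_dir (convex hull set us)) (snd (oriented_simplex us))
     (cell_dir (convex hull set (take (p + 1) us))) (snd (oriented_simplex (take (p + 1) us)))
     (cell_dir (convex hull set (drop p us))) (snd (oriented_simplex (drop p us)))"
proof -
  define bs where "bs = map (\<lambda>u. u - hd us) (tl us)"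
  define bs1 where "bs1 = map (\<lambda>u. u - hd us) (take p (tl us))"
  define bs2 where "bs2 = map (\<lambda>u. u - us ! p) (drop (Suc p) us)"
  have ne: "us \<noteq> []" using p by auto
  have orient: "snd (oriented_simplex us) = orientation_of bs"
    "snd (oriented_simplex (take (p + 1) us)) = orientation_of bs1"
    "snd (oriented_simplex (drop p us)) = orientation_of bs2"
    using p by (simp_all add: oriented_simplex_def bs_def bs1_def bs2_def tl_take hd_drop_conv_nth tl_drop drop_Suc)
  have sub: "\<not> affine_dependent (set (take (p + 1) us))" "\<not> affine_dependent (set (drop p us))"
    using indep affine_dependent_subset[OF _ set_take_subset] affine_dependent_subset[OF _ set_drop_subset]
    by metis+
  have bs: "ordered_basis (cell_dir (convex hull set us)) bs"
    using ordered_basis_simplex[OF ne dist indep] by (simp add: bs_def)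
  have bs1: "ordered_basis (cell_dir (convex hull set (take (p + 1) us))) bs1"
    using ordered_basis_simplex[OF _ _ sub(1)] ne dist by (simp add: bs1_def tl_take)
  have bs2: "ordered_basis (cell_dir (convex hull set (drop p us))) bs2"
    using ordered_basis_simplex[OF _ _ sub(2)] p dist
    by (simp add: bs2_def hd_drop_conv_nth tl_drop drop_Suc)
  have len: "length (bs1 @ bs2) = length bs" "length bs1 = p"
    using p by (auto simp: bs_def bs1_def bs2_def)
  have "(bs1 @ bs2) ! j - bs ! j \<in> span (set (take j bs))" if j: "j < length bs" for j
  proof (cases "j < p")
    case True
    then have "(bs1 @ bs2) ! j = bs ! j"
      using j by (simp add: bs_def bs1_def nth_append)
    then show ?thesis by (simp add: real_vector.span_zero)
  next
    case False
    have "(bs1 @ bs2) ! j - bs ! j = - (us ! p - us ! 0)"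
      using False j p by (simp add: nth_append len bs_def bs2_def nth_tl hd_conv_nth[OF ne])
    moreover have "us ! p - us ! 0 \<in> span (set (take j bs))"
    proof (cases p)
      case 0
      then show ?thesis by (simp add: real_vector.span_zero)
    next
      case (Suc k)
      then have "us ! p - us ! 0 = take j bs ! k" "k < length (take j bs)"
        using False j p by (auto simp: bs_def nth_tl hd_conv_nth[OF ne])
      then show ?thesis by (metis nth_mem real_vector.span_base)
    qed
    ultimately show ?thesis by (metis real_vector.span_neg)
  qed
  from ordered_basis_unitriangular[OF bs len(1) this] basis_change_det_unitriangular[OF bs len(1) this]
  show ?thesis
    unfolding orient using bs1 bs2
    by (intro oriented_direct_sum_append[OF bs]) (auto simp: ordered_basis_def)
qed

lemma oriented_simplex_orientation:
  assumes "us \<noteq> []" "distinct us" "\<not> affine_dependent (set us)"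
  shows "snd (oriented_simplex us) \<in> orientations (cell_dir (convex hull set us))"
  using orientation_of_in_orientations[OF ordered_basis_simplex[OF assms]]
  by (simp add: oriented_simplex_def)

section \<open>Dual cones of faces of a simplex\<close>

lemma subspace_cell_dir: "subspace (cell_dir c)"
  by (simp add: cell_dir_def real_vector.subspace_span)

lemma diff_in_cell_dir: "x \<in> c \<Longrightarrow> y \<in> c \<Longrightarrow> x - y \<in> cell_dir c"
  unfolding cell_dir_def by (rule real_vector.span_base) blast

lemma restrict_functional_in_dual_space:
  "linear f \<Longrightarrow> subspace W \<Longrightarrow> restrict_functional W f \<in> dual_space W"
  by (simp add: dual_space_def restrict_functional_def linear_add linear_scale
      real_vector.subspace_add real_vector.subspace_scale)

text \<open>
  Elements of the dual of a subspace can thus be handled as global functionals, for which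
  linearity needs no side conditions.
\<close>

lemma dual_space_extension:
  assumes w: "w \<in> dual_space W" and W: "subspace W"
  obtains f where "linear f" "w = restrict_functional W f"
proof -
  obtain B where B: "B \<subseteq> W" "independent B" "W \<subseteq> span B"
    using real_vector.maximal_independent_subset[of W] by metis
  obtain f where f: "linear f" "\<forall>x\<in>B. f x = w x"
    using linear_independent_extend[OF B(2)] by blast
  have "w 0 = 0"
    using w real_vector.subspace_0[OF W] unfolding dual_space_def
    by (metis (mono_tags, lifting) mem_Collect_eq mult_zero_left scale_zero_left)
  then have "subspace {x \<in> W. f x = w x}"
    using w W f(1) unfolding dual_space_def
    by (auto simp: real_vector.subspace_def linear_0 linear_add linear_scale)
  then have "span B \<subseteq> {x \<in> W. f x = w x}"
    using B f(2) by (intro real_vector.span_minimal) auto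
  then have "f x = w x" if "x \<in> W" for x using that B(3) by blast
  then have "w = restrict_functional W f"
    using w unfolding dual_space_def restrict_functional_def by auto
  then show ?thesis using that f(1) by blast
qed

text \<open>
  The base point in the definition of the dual cone cancels: the cone consists of the functionals
  whose maximum on the cell is attained on the face.
\<close>

lemma restrict_in_dual_cone_iff:
  assumes f: "linear f" and "\<delta> \<subseteq> \<gamma>"
  shows "restrict_functional (cell_dir \<gamma>) f \<in> dual_cone \<gamma> \<delta> \<longleftrightarrow> (\<forall>x\<in>\<delta>. \<forall>y\<in>\<gamma>. f y \<le> f x)"
proof -
  have "restrict_functional (cell_dir \<gamma>) f (y - a) = f y - f a" if "y \<in> \<gamma>" "a \<in> \<gamma>" for y a
    using diff_in_cell_dir[OF that] linear_diff[OF f] by (simp add: restrict_functional_def)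
  then show ?thesis
    using assms restrict_functional_in_dual_space[OF f subspace_cell_dir]
    unfolding dual_cone_def by (auto simp: subset_iff)
qed

lemma linear_le_on_hulls_iff:
  assumes f: "linear (f :: 'a::real_vector \<Rightarrow> real)"
  shows "(\<forall>x\<in>convex hull I. \<forall>y\<in>convex hull S. f y \<le> f x) \<longleftrightarrow> (\<forall>x\<in>I. \<forall>y\<in>S. f y \<le> f x)"
proof
  assume le: "\<forall>x\<in>I. \<forall>y\<in>S. f y \<le> f x"
  have below: "convex {y. f y \<le> c}" and above: "convex {y. c \<le> f y}" for c
    using convex_linear_vimage[OF f, of "{..c}"] convex_linear_vimage[OF f, of "{c..}"]
    by (simp_all add: vimage_def)
  have "f y \<le> f x" if "x \<in> I" "y \<in> convex hull S" for x y
    using hull_minimal[where S = convex, OF _ below[of "f x"], of S] le that by auto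
  then show "\<forall>x\<in>convex hull I. \<forall>y\<in>convex hull S. f y \<le> f x"
    using hull_minimal[where S = convex, OF _ above, of I] by (smt (verit) mem_Collect_eq subset_iff)
qed (simp add: hull_inc)

text \<open>
  On affinely independent points the values of an affine function can be prescribed; the linear
  function realises them up to the additive constant fixed at \<open>a\<close>.
\<close>

lemma linear_interpolation:
  assumes "\<not> affine_dependent S" "a \<in> S"
  obtains f :: "'a::real_vector \<Rightarrow> real" where "linear f" "\<And>x. x \<in> S \<Longrightarrow> f x - f a = g x - g a"
proof -
  have indep: "independent ((\<lambda>x. - a + x) ` (S - {a}))"
    using affine_dependent_iff_dependent2 assms by blast
  obtain f where f: "linear f" "\<forall>y \<in> (\<lambda>x. - a + x) ` (S - {a}). f y = g (a + y) - g a"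
    using linear_independent_extend[OF indep, of "\<lambda>y. g (a + y) - g a"] by blast
  have "f x - f a = g x - g a" if "x \<in> S" for x
    using f(2) that linear_diff[OF f(1), of x a] by (cases "x = a") auto
  then show ?thesis using that f(1) by blast
qed

text \<open>
  An intersection point is given by a functional \<open>f\<close> that is maximal on \<open>S\<close> at the points of \<open>I\<close>
  while \<open>v + f\<close> is maximal at the points of \<open>J\<close>. Then \<open>f j \<le> f i\<close> and
  \<open>v i + f i \<le> v j + f j\<close>, whence \<open>v i \<le> v j\<close>. Conversely, let \<open>m\<close> be the maximum of \<open>v\<close> on \<open>I\<close>
  and choose \<open>f\<close> such that \<open>v + f\<close> is, up to a constant, the truncation of \<open>v\<close> at height \<open>m\<close>:
  the truncation is nowhere above \<open>v\<close> and agrees with \<open>v\<close> on \<open>I\<close>, and it takes its largest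
  possible value \<open>m\<close> on \<open>J\<close>.
\<close>

lemma shifted_dual_cone_meets_iff:
  fixes S :: "'a::euclidean_space set"
  assumes v: "linear v" and S: "\<not> affine_dependent S"
    and I: "I \<subseteq> S" "I \<noteq> {}" and J: "J \<subseteq> S"
  shows "shifted_cone v (convex hull S) (dual_cone (convex hull S) (convex hull I))
      \<inter> dual_cone (convex hull S) (convex hull J) \<noteq> {} \<longleftrightarrow> (\<forall>i\<in>I. \<forall>j\<in>J. v i \<le> v j)"
    (is "?L \<longleftrightarrow> ?R")
proof -
  let ?\<gamma> = "convex hull S"
  let ?res = "restrict_functional (cell_dir ?\<gamma>)"
  have in_cone: "?res f \<in> dual_cone ?\<gamma> (convex hull K) \<longleftrightarrow> (\<forall>x\<in>K. \<forall>y\<in>S. f y \<le> f x)"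
    if "linear f" "K \<subseteq> S" for f K
    using restrict_in_dual_cone_iff[OF that(1) hull_mono[OF that(2)]] linear_le_on_hulls_iff[OF that(1)]
    by blast
  have add: "?res v + ?res f = ?res (\<lambda>x. v x + f x)" for f
    by (auto simp: restrict_functional_def fun_eq_iff)
  have "?L \<longleftrightarrow> (\<exists>f. linear f \<and> ?res f \<in> dual_cone ?\<gamma> (convex hull I) \<and>
      ?res (\<lambda>x. v x + f x) \<in> dual_cone ?\<gamma> (convex hull J))"
  proof
    assume ?L
    then obtain w where w: "w \<in> dual_cone ?\<gamma> (convex hull I)"
      "?res v + w \<in> dual_cone ?\<gamma> (convex hull J)"
      by (auto simp: shifted_cone_def)
    then have "w \<in> dual_space (cell_dir ?\<gamma>)" by (simp add: dual_cone_def)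
    from this subspace_cell_dir obtain f where "linear f" "w = ?res f"
      by (rule dual_space_extension)
    then show "\<exists>f. linear f \<and> ?res f \<in> dual_cone ?\<gamma> (convex hull I) \<and>
        ?res (\<lambda>x. v x + f x) \<in> dual_cone ?\<gamma> (convex hull J)"
      using w add[of f] by auto
  next
    assume "\<exists>f. linear f \<and> ?res f \<in> dual_cone ?\<gamma> (convex hull I) \<and>
        ?res (\<lambda>x. v x + f x) \<in> dual_cone ?\<gamma> (convex hull J)"
    then obtain f where "?res f \<in> dual_cone ?\<gamma> (convex hull I)"
      "?res v + ?res f \<in> dual_cone ?\<gamma> (convex hull J)"
      using add by auto
    then show ?L by (auto simp: shifted_cone_def)
  qed
  also have "\<dots> \<longleftrightarrow> (\<exists>f. linear f \<and> (\<forall>x\<in>I. \<forall>y\<in>S. f y \<le> f x) \<and>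
      (\<forall>x\<in>J. \<forall>y\<in>S. v y + f y \<le> v x + f x))"
    by (intro ex_cong1 conj_cong refl)
      (simp_all add: in_cone I(1) J linear_compose_add[OF v])
  also have "\<dots> \<longleftrightarrow> ?R"
  proof
    assume "\<exists>f. linear f \<and> (\<forall>x\<in>I. \<forall>y\<in>S. f y \<le> f x) \<and> (\<forall>x\<in>J. \<forall>y\<in>S. v y + f y \<le> v x + f x)"
    then show ?R using I(1) J by (smt (verit) subset_iff)
  next
    assume R: ?R
    have "finite I" using S I(1) aff_independent_finite finite_subset by blast
    define m where "m = Max (v ` I)"
    have m: "v i \<le> m" if "i \<in> I" for i
      using that \<open>finite I\<close> by (simp add: m_def)
    have mJ: "m \<le> v j" if "j \<in> J" for j
      using that R \<open>finite I\<close> I(2) by (simp add: m_def)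
    obtain a where a: "a \<in> S" using I by auto
    define g where "g = (\<lambda>x. min (v x) m - v x)"
    obtain f where f: "linear f" "\<And>x. x \<in> S \<Longrightarrow> f x - f a = g x - g a"
      using linear_interpolation[OF S a] by blast
    have fg: "f x = g x + (f a - g a)" if "x \<in> S" for x
      using f(2)[OF that] by simp
    \<comment> \<open>\<open>g\<close> is nowhere positive and vanishes on \<open>I\<close>.\<close>
    have "f y \<le> f x" if "x \<in> I" "y \<in> S" for x y
      using m[OF that(1)] fg[of x] fg[of y] that I(1) by (auto simp: g_def)
    \<comment> \<open>\<open>v + g\<close> is nowhere above \<open>m\<close> and equals \<open>m\<close> on \<open>J\<close>.\<close>
    moreover have "v y + f y \<le> v x + f x" if "x \<in> J" "y \<in> S" for x y
      using mJ[OF that(1)] fg[of x] fg[of y] that J by (auto simp: g_def)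
    ultimately show "\<exists>f. linear f \<and> (\<forall>x\<in>I. \<forall>y\<in>S. f y \<le> f x) \<and>
        (\<forall>x\<in>J. \<forall>y\<in>S. v y + f y \<le> v x + f x)"
      using f(1) by blast
  qed
  finally show ?thesis .
qed

section \<open>Convenient points separate the ends of edges\<close>

lemma dual_cone_segment:
  fixes a b :: "'a::real_vector"
  shows "dual_cone (convex hull {a, b}) (convex hull {a, b}) = {0}"
proof -
  let ?W = "cell_dir (convex hull {a, b})"
  have W: "?W = range (\<lambda>k. k *\<^sub>R (b - a))"
    using cell_dir_convex_hull[of a "{a, b}"] by (simp add: real_vector.span_singleton)
  have in_cone: "restrict_functional ?W f \<in> dual_cone (convex hull {a, b}) (convex hull {a, b}) \<longleftrightarrow> f a = f b"
    if "linear f" for f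
    using restrict_in_dual_cone_iff[OF that, of "convex hull {a, b}"] linear_le_on_hulls_iff[OF that, of "{a, b}" "{a, b}"]
    by auto
  have zero: "restrict_functional ?W f = 0" if "linear f" "f a = f b" for f
    using that W by (auto simp: restrict_functional_def fun_eq_iff linear_scale linear_diff)
  have "w = 0" if "w \<in> dual_cone (convex hull {a, b}) (convex hull {a, b})" for w
  proof -
    from that have "w \<in> dual_space ?W" by (simp add: dual_cone_def)
    then obtain f where "linear f" "w = restrict_functional ?W f"
      using subspace_cell_dir by (rule dual_space_extension)
    then show ?thesis using that in_cone zero by metis
  qed
  moreover have "0 \<in> dual_cone (convex hull {a, b}) (convex hull {a, b})"
    using in_cone[of "\<lambda>_. 0"] zero[of "\<lambda>_. 0"] by (simp add: linear_zero)
  ultimately show ?thesis by auto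
qed

lemma dim_dual_space_segment:
  fixes a b :: "'a::euclidean_space"
  assumes "a \<noteq> b"
  shows "dim (dual_space (cell_dir (convex hull {a, b}))) = 1"
proof -
  let ?W = "cell_dir (convex hull {a, b})"
  have W: "?W = range (\<lambda>k. k *\<^sub>R (b - a))"
    using cell_dir_convex_hull[of a "{a, b}"] by (simp add: real_vector.span_singleton)
  obtain f :: "'a \<Rightarrow> real" where f: "linear f" "f b - f a = 1"
  proof (rule linear_interpolation[of "{a, b}" a "\<lambda>x. if x = b then 1 else 0"])
    fix f :: "'a \<Rightarrow> real"
    assume "linear f" "\<And>x. x \<in> {a, b} \<Longrightarrow> f x - f a = (if x = b then 1 else 0) - (if a = b then 1 else 0)"
    then show thesis using that assms by simp
  qed (simp_all add: affine_independent_2)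
  let ?w = "restrict_functional ?W f"
  have w: "?w \<in> dual_space ?W"
    by (rule restrict_functional_in_dual_space[OF f(1) subspace_cell_dir])
  have ba: "b - a \<in> ?W" by (rule diff_in_cell_dir) (simp_all add: hull_inc)
  have wba: "?w (b - a) = 1" using ba f linear_diff[OF f(1)] by (simp add: restrict_functional_def)
  have "u = u (b - a) *\<^sub>R ?w" if u: "u \<in> dual_space ?W" for u
  proof
    fix x
    show "u x = (u (b - a) *\<^sub>R ?w) x"
    proof (cases "x \<in> ?W")
      case True
      then obtain k where k: "x = k *\<^sub>R (b - a)" using W by auto
      have "u x = k * u (b - a)" "?w x = k * ?w (b - a)"
        using u w ba unfolding k dual_space_def by blast+
      then show ?thesis using wba by (simp add: scaleR_fun_def)
    next
      case False
      then show ?thesis using u by (simp add: scaleR_fun_def dual_space_def restrict_functional_def)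
    qed
  qed
  then have "dual_space ?W \<subseteq> span {?w}"
    by (metis real_vector.span_base real_vector.span_scale singletonI subsetI)
  moreover have "?w \<noteq> 0" using wba by auto
  ultimately show ?thesis
    using w by (intro real_vector.dim_unique[of "{?w}"]) (simp_all add: real_vector.dependent_single)
qed

text \<open>
  Apply convenience to the edge with \<open>(p, q) = (0, 1)\<close>. The zero cone, dual to the whole edge,
  belongs to both skeleta, and it is its own shift if \<open>v\<close> is constant on the edge. It would then
  have to be transversal to itself in a space of dimension 1, which is impossible since its
  codimension is not zero.
\<close>

lemma convenient_distinct_on_edge:
  fixes X :: "'a::euclidean_space set set"
  assumes v: "v \<in> convenient X" and edge: "convex hull {a, b} \<in> X" and ab: "a \<noteq> b"
  shows "v a \<noteq> v b"
proof
  assume eq: "v a = v b"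
  let ?\<gamma> = "convex hull {a, b}"
  let ?E = "dual_space (cell_dir ?\<gamma>)"
  have "v \<in> convenient_pq X 0 1" using v by (auto simp: convenient_def)
  then have lin: "v \<in> dual_space UNIV"
    and tr: "cell_dim ?\<gamma> = 0 + 1 \<longrightarrow> transversal ?E (shifted_cone v ?\<gamma> ` skeleton 1 (dual_fan ?\<gamma>)) (skeleton 0 (dual_fan ?\<gamma>))"
    using edge unfolding convenient_pq_def by blast+
  have "cell_dim ?\<gamma> = 1"
    using cell_dim_simplex[of "{a, b}"] ab affine_independent_2 by simp
  with tr have tr: "transversal ?E (shifted_cone v ?\<gamma> ` skeleton 1 (dual_fan ?\<gamma>)) (skeleton 0 (dual_fan ?\<gamma>))"
    by simp
  have dir0: "cell_dir {0 :: 'a \<Rightarrow> real} = {0}"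
    by (simp add: cell_dir_def)
  have dim0: "dim {0 :: 'a \<Rightarrow> real} = 0"
    using real_vector.dim_unique[of "{}" "{0 :: 'a \<Rightarrow> real}" 0]
    by (simp add: real_vector.independent_empty)
  have "dual_cone ?\<gamma> ?\<gamma> \<in> dual_fan ?\<gamma>"
    unfolding dual_fan_def faces_def by (intro imageI CollectI conjI face_of_refl convex_convex_hull) simp
  then have "{0} \<in> dual_fan ?\<gamma>" by (simp add: dual_cone_segment)
  then have skel: "{0} \<in> skeleton j (dual_fan ?\<gamma>)" for j
    by (simp add: skeleton_def cell_dim_def dir0 dim0)
  have "v (x + y) = v x + v y" "v (c *\<^sub>R x) = c * v x" for x y c
    using lin by (simp_all add: dual_space_def)
  then have "linear v" by (intro linearI) simp_all
  then have "restrict_functional (cell_dir ?\<gamma>) v \<in> dual_cone ?\<gamma> ?\<gamma>"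
    using restrict_in_dual_cone_iff[of v ?\<gamma> ?\<gamma>] linear_le_on_hulls_iff[of v "{a, b}" "{a, b}"] eq by auto
  then have "shifted_cone v ?\<gamma> {0} = {0}"
    by (simp add: dual_cone_segment shifted_cone_def)
  then have "{0} \<in> shifted_cone v ?\<gamma> ` skeleton 1 (dual_fan ?\<gamma>)"
    using skel by (metis imageI)
  with tr skel[of 0] have "codim_in ?E (cell_dir {0} \<inter> cell_dir {0}) = codim_in ?E (cell_dir {0}) + codim_in ?E (cell_dir {0})"
    unfolding transversal_def by blast
  then show False
    using dim_dual_space_segment[OF ab] by (simp add: dir0 codim_in_def dim0)
qed

section \<open>The product on a simplex\<close>

text \<open>
  Two sets of sizes \<open>p + 1\<close> and \<open>q + 1\<close> in a list of \<open>p + q + 1\<close> entries have a common element \<open>x\<close>.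
  The first set lies weakly before \<open>x\<close> and the second weakly after it, and counting leaves
  only the position \<open>p\<close> for \<open>x\<close> and no room for other elements.
\<close>

lemma
  fixes f :: "'a \<Rightarrow> 'b::linorder"
  assumes sorted: "sorted_wrt (\<lambda>a b. f a < f b) us" and len: "length us = p + q + 1"
    and I: "I \<subseteq> set us" "card I = p + 1" and J: "J \<subseteq> set us" "card J = q + 1"
    and le: "\<And>x y. x \<in> I \<Longrightarrow> y \<in> J \<Longrightarrow> f x \<le> f y"
  shows initial_segment_if_below: "I = set (take (p + 1) us)"
    and final_segment_if_above: "J = set (drop p us)"
proof -
  have less: "f (us ! i) < f (us ! j)" if "i < j" "j < length us" for i j
    using sorted that by (simp add: sorted_wrt_iff_nth_less)
  have nth_le: "f (us ! i) \<le> f (us ! j) \<longleftrightarrow> i \<le> j" if "i < length us" "j < length us" for i j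
    using that less[of i j] less[of j i] by (cases i j rule: linorder_cases) auto
  have fin: "finite I" "finite J" using I J finite_subset by blast+
  have "card (I \<union> J) \<le> p + q + 1"
    using card_mono[of "set us" "I \<union> J"] card_length[of us] I J len by simp
  then have "card (I \<inter> J) > 0" using card_Un_Int[OF fin] I J by simp
  then obtain x where x: "x \<in> I" "x \<in> J" by (metis Int_iff card_gt_0_iff ex_in_conv)
  then obtain k where k: "k < length us" "x = us ! k" using I by (metis in_set_conv_nth subsetD)
  have sub_I: "I \<subseteq> set (take (k + 1) us)"
  proof
    fix y assume y: "y \<in> I"
    then obtain i where i: "i < length us" "y = us ! i" using I by (metis in_set_conv_nth subsetD)
    then have "i \<le> k" using le[OF y x(2)] nth_le[OF i(1) k(1)] k by simp
    then have "i < length (take (k + 1) us)" "y = take (k + 1) us ! i" using i by auto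
    then show "y \<in> set (take (k + 1) us)" by (metis nth_mem)
  qed
  have sub_J: "J \<subseteq> set (drop k us)"
  proof
    fix y assume y: "y \<in> J"
    then obtain i where i: "i < length us" "y = us ! i" using J by (metis in_set_conv_nth subsetD)
    then have "k \<le> i" using le[OF x(1) y] nth_le[OF k(1) i(1)] k by simp
    then have "i - k < length (drop k us)" "y = drop k us ! (i - k)" using i by auto
    then show "y \<in> set (drop k us)" by (metis nth_mem)
  qed
  have cards: "card (set (take (k + 1) us)) \<le> k + 1" "card (set (drop k us)) \<le> p + q + 1 - k"
    using card_length[of "take (k + 1) us"] card_length[of "drop k us"] len by auto
  have "k = p"
    using card_mono[OF _ sub_I] card_mono[OF _ sub_J] cards I J k len by simp
  then show "I = set (take (p + 1) us)" "J = set (drop p us)"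
    using card_seteq[OF _ sub_I] card_seteq[OF _ sub_J] cards I J by simp_all
qed

lemma faces_simplex_iff:
  fixes S :: "'a::euclidean_space set"
  assumes "\<not> affine_dependent S"
  shows "\<delta> \<in> faces (convex hull S) \<longleftrightarrow> (\<exists>I\<subseteq>S. I \<noteq> {} \<and> \<delta> = convex hull I)"
proof -
  have "\<delta> face_of (convex hull S) \<longleftrightarrow> (\<exists>I\<subseteq>S. \<delta> = convex hull I)"
    using face_of_convex_hull_affine_independent[OF assms] by simp
  then show ?thesis
    unfolding faces_def mem_Collect_eq by (metis convex_hull_eq_empty)
qed

lemma sorted_wrt_less_imp_distinct:
  fixes f :: "'a \<Rightarrow> 'b::linorder"
  shows "sorted_wrt (\<lambda>a b. f a < f b) us \<Longrightarrow> distinct us"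
  by (induction us) auto

text \<open>
  Nonempty faces correspond to nonempty sets of vertices, so the pairs in question are pairs
  \<open>I\<close>, \<open>J\<close> of sizes \<open>p + 1\<close> and \<open>q + 1\<close> with all values of \<open>v\<close> on \<open>I\<close> at most all
  values on \<open>J\<close>; there is only one such pair.
\<close>

lemma face_pairs_simplex:
  fixes us :: "'a::euclidean_space list"
  assumes v: "linear v" and indep: "\<not> affine_dependent (set us)" and len: "length us = p + q + 1"
    and sorted: "sorted_wrt (\<lambda>a b. v a < v b) us"
  shows "face_pairs p q (convex hull set us) v =
    {(convex hull set (take (p + 1) us), convex hull set (drop p us))}"
proof -
  let ?\<gamma> = "convex hull set us"
  have dist: "distinct us"
    using sorted by (rule sorted_wrt_less_imp_distinct)
  note faces = faces_simplex_iff[OF indep]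
  have dim: "cell_dim (convex hull I) = card I - 1" "0 < card I" if "I \<subseteq> set us" "I \<noteq> {}" for I
  proof -
    have "\<not> affine_dependent I" using affine_dependent_subset[OF _ that(1)] indep by blast
    then show "cell_dim (convex hull I) = card I - 1" by (rule cell_dim_simplex[OF _ that(2)])
    show "0 < card I" using that finite_subset[OF that(1)] by (simp add: card_gt_0_iff)
  qed
  have only: "\<delta> = convex hull set (take (p + 1) us) \<and> \<mu> = convex hull set (drop p us)"
    if "(\<delta>, \<mu>) \<in> face_pairs p q ?\<gamma> v" for \<delta> \<mu>
  proof -
    from that have fp: "\<delta> \<in> faces ?\<gamma>" "\<mu> \<in> faces ?\<gamma>" "cell_dim \<delta> = p" "cell_dim \<mu> = q"
      and meet: "shifted_cone v ?\<gamma> (dual_cone ?\<gamma> \<delta>) \<inter> dual_cone ?\<gamma> \<mu> \<noteq> {}"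
      by (simp_all add: face_pairs_def)
    from fp obtain I J where I: "I \<subseteq> set us" "I \<noteq> {}" "\<delta> = convex hull I"
      and J: "J \<subseteq> set us" "J \<noteq> {}" "\<mu> = convex hull J"
      using faces by metis
    have cards: "card I = p + 1" "card J = q + 1"
      using dim[OF I(1,2)] dim[OF J(1,2)] fp I(3) J(3) by auto
    have "v x \<le> v y" if "x \<in> I" "y \<in> J" for x y
      using meet that unfolding I(3) J(3) shifted_dual_cone_meets_iff[OF v indep I(1,2) J(1)] by blast
    then show ?thesis
      using initial_segment_if_below[OF sorted len I(1) cards(1) J(1) cards(2)]
        final_segment_if_above[OF sorted len I(1) cards(1) J(1) cards(2)] I(3) J(3) by simp
  qed
  have "(convex hull set (take (p + 1) us), convex hull set (drop p us)) \<in> face_pairs p q ?\<gamma> v"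
  proof -
    let ?I = "set (take (p + 1) us)" and ?J = "set (drop p us)"
    have I: "?I \<subseteq> set us" "?I \<noteq> {}" and J: "?J \<subseteq> set us" "?J \<noteq> {}"
      using len by (auto dest: in_set_takeD in_set_dropD)
    have "card ?I = p + 1" "card ?J = q + 1"
      using dist len distinct_card[of "take (p + 1) us"] distinct_card[of "drop p us"] by simp_all
    then have "cell_dim (convex hull ?I) = p" "cell_dim (convex hull ?J) = q"
      using dim[OF I] dim[OF J] by simp_all
    moreover have "convex hull ?I \<in> faces ?\<gamma>" "convex hull ?J \<in> faces ?\<gamma>"
      using faces I J by blast+
    moreover have "v x \<le> v y" if x: "x \<in> ?I" and y: "y \<in> ?J" for x y
    proof -
      obtain i where i: "i < p + 1" "x = us ! i"
        using x len by (auto simp: in_set_conv_nth)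
      obtain j where j: "j < q + 1" "y = us ! (p + j)"
        using y len by (auto simp: in_set_conv_nth)
      show ?thesis
        using sorted i j len unfolding sorted_wrt_iff_nth_less
        by (cases "i = p + j") (auto intro: less_imp_le)
    qed
    ultimately show ?thesis
      using shifted_dual_cone_meets_iff[OF v indep I J(1)] by (simp add: face_pairs_def)
  qed
  then show ?thesis
  proof (intro equalityI subsetI)
    fix z assume "z \<in> face_pairs p q ?\<gamma> v"
    then show "z \<in> {(convex hull set (take (p + 1) us), convex hull set (drop p us))}"
      using only[of "fst z" "snd z"] by (simp add: prod_eq_iff)
  qed simp
qed

text \<open>
  The two sign changes cancel, which makes the value of the product independent of the
  chosen pair of compatible orientations.
\<close>

lemma cochain_product_opposite:
  assumes "r \<in> cochains X p" "s \<in> cochains X q"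
    and "(c, \<epsilon>) \<in> oriented_cells X p" "(d, \<eta>) \<in> oriented_cells X q"
  shows "r (c, - \<epsilon>) * s (d, - \<eta>) = r (c, \<epsilon>) * s (d, \<eta>)"
  using assms unfolding cochains_def by fastforce

theorem corollary1:
  fixes X :: "'a::euclidean_space set set"
    and G :: "nat \<Rightarrow> 's::{ring,monoid_mult} set"
    and v :: "'a \<Rightarrow> real"
    and num :: "'a \<Rightarrow> nat"
    and p q :: nat
    and r\<^sub>p r\<^sub>q :: "'a ocell \<Rightarrow> 's"
    and us :: "'a list"
  assumes complex: "p_complex X" and compact_cells: "\<forall>c\<in>X. compact c"
    and simplicial: "simplicial X"
    and ring: "supercommutative G"
    and convenient: "v \<in> convenient X"
    and numbering: "bij_betw num (complex_vertices X) {1..card (complex_vertices X)}"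
    and ascending: "\<forall>a\<in>complex_vertices X. \<forall>b\<in>complex_vertices X. v a < v b \<longrightarrow> num a < num b"
    and cochains: "r\<^sub>p \<in> cochains X p" "r\<^sub>q \<in> cochains X q"
    and simplex: "length us = p + q + 1" "\<not> affine_dependent (set us)" "convex hull (set us) \<in> X"
    and increasing: "sorted_wrt (\<lambda>a b. num a < num b) us"
  shows "cup p q v r\<^sub>p r\<^sub>q (oriented_simplex us) =
    r\<^sub>p (oriented_simplex (take (p + 1) us)) * r\<^sub>q (oriented_simplex (drop p us))"
proof -
  let ?\<gamma> = "convex hull set us"
  let ?us1 = "take (p + 1) us" and ?us2 = "drop p us"
  have len: "length us = p + q + 1" and ne: "us \<noteq> []" using simplex(1) by auto
  have cell: "convex hull I \<in> X" if "I \<subseteq> set us" "I \<noteq> {}" for I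
  proof -
    have "convex hull I \<in> faces ?\<gamma>"
      using faces_simplex_iff[OF simplex(2)] that by blast
    then show ?thesis using complex simplex(3) unfolding p_complex_def by blast
  qed
  have vertex: "x \<in> complex_vertices X" if "x \<in> set us" for x
    using cell[of "{x}"] that by (simp add: complex_vertices_def)
  have dist: "distinct us"
    using increasing by (rule sorted_wrt_less_imp_distinct)
  \<comment> \<open>The numbering may break ties of \<open>v\<close> arbitrarily, but there are no ties along an edge.\<close>
  have "v x < v y" if xy: "x \<in> set us" "y \<in> set us" "num x < num y" for x y
  proof -
    have "\<not> v y < v x" using ascending vertex xy by (meson order_less_asym)
    moreover have "v x \<noteq> v y"
      using convenient_distinct_on_edge[OF convenient cell[of "{x, y}"]] xy by auto
    ultimately show ?thesis by simp
  qed
  then have sorted: "sorted_wrt (\<lambda>a b. v a < v b) us"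
    by (rule sorted_wrt_mono_rel[OF _ increasing])
  have "v \<in> convenient_pq X 0 0"
    using convenient by (simp add: convenient_def)
  then have "v \<in> dual_space UNIV" by (simp add: convenient_pq_def)
  then have lin: "linear v"
    by (intro linearI) (simp_all add: dual_space_def)
  have pairs: "face_pairs p q ?\<gamma> v = {(convex hull set ?us1, convex hull set ?us2)}"
    by (rule face_pairs_simplex[OF lin simplex(2) len sorted])
  have ne12: "?us1 \<noteq> []" "?us2 \<noteq> []" using len by auto
  have sub: "set ?us1 \<subseteq> set us" "set ?us2 \<subseteq> set us"
    by (rule set_take_subset set_drop_subset)+
  have dist12: "distinct ?us1" "distinct ?us2" using dist by simp_all
  have indep12: "\<not> affine_dependent (set ?us1)" "\<not> affine_dependent (set ?us2)"
    using simplex(2) sub affine_dependent_subset by metis+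
  obtain \<epsilon>1 where e1: "oriented_simplex ?us1 = (convex hull set ?us1, \<epsilon>1)"
    by (simp add: oriented_simplex_def)
  obtain \<epsilon>2 where e2: "oriented_simplex ?us2 = (convex hull set ?us2, \<epsilon>2)"
    by (simp add: oriented_simplex_def)
  obtain \<epsilon> where e: "oriented_simplex us = (?\<gamma>, \<epsilon>)"
    by (simp add: oriented_simplex_def)
  have cells: "(convex hull set ?us1, \<epsilon>1) \<in> oriented_cells X p" "(convex hull set ?us2, \<epsilon>2) \<in> oriented_cells X q"
  proof -
    have "cell_dim (convex hull set ?us1) = p" "cell_dim (convex hull set ?us2) = q"
      using cell_dim_simplex[OF indep12(1)] cell_dim_simplex[OF indep12(2)] ne12 len
        distinct_card[OF dist12(1)] distinct_card[OF dist12(2)] by simp_all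
    then show "(convex hull set ?us1, \<epsilon>1) \<in> oriented_cells X p" "(convex hull set ?us2, \<epsilon>2) \<in> oriented_cells X q"
      using oriented_simplex_orientation[OF ne12(1) dist12(1) indep12(1)]
        oriented_simplex_orientation[OF ne12(2) dist12(2) indep12(2)] cell sub ne12 e1 e2
      by (simp_all add: oriented_cells_def)
  qed
  let ?sum = "\<lambda>(\<eta>1, \<eta>2). oriented_direct_sum (cell_dir ?\<gamma>) \<epsilon>
    (cell_dir (convex hull set ?us1)) \<eta>1 (cell_dir (convex hull set ?us2)) \<eta>2"
  have sum: "?sum (\<epsilon>1, \<epsilon>2)"
    using oriented_direct_sum_simplex[OF dist simplex(2), of p] len e e1 e2 by simp
  obtain \<eta>1 \<eta>2 where eta: "(SOME \<eta>. ?sum \<eta>) = (\<eta>1, \<eta>2)" by (cases "SOME \<eta>. ?sum \<eta>")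
  have "?sum (\<eta>1, \<eta>2)" using someI[of ?sum, OF sum] unfolding eta .
  then have "(\<eta>1, \<eta>2) = (\<epsilon>1, \<epsilon>2) \<or> (\<eta>1, \<eta>2) = (- \<epsilon>1, - \<epsilon>2)"
    using oriented_direct_sum_unique[OF _ _ ordered_basis_simplex[OF ne12(1) dist12(1) indep12(1)]
      ordered_basis_simplex[OF ne12(2) dist12(2) indep12(2)]] sum by simp
  then have "r\<^sub>p (convex hull set ?us1, \<eta>1) * r\<^sub>q (convex hull set ?us2, \<eta>2) =
      r\<^sub>p (convex hull set ?us1, \<epsilon>1) * r\<^sub>q (convex hull set ?us2, \<epsilon>2)"
    using cochain_product_opposite[OF cochains cells] by auto
  then show ?thesis
    unfolding e e1 e2 cup_def by (simp add: pairs eta[simplified])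
qed

end
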